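(* For any distribution $D$ on $\mathcal X\times\{-1,1\}$, any set $\mathcal H$ of voters $\mathcal X\to[-1,1]$, any prior distribution $P$ on $\mathcal H$ and any $\delta\in(0,1]$, with probability at least $1-\delta$ over $S\sim D^m$, for all posteriors $Q$ on $\mathcal H$, $$\mathrm{kl}\big(\alpha_Q^S\,\|\,\alpha_Q^D\big)\ \le\ \frac1m\Big[2\,\mathrm{KL}(Q\|P)+\ln\frac{\xi(m)}\delta\Big],$$ where $\alpha_Q^{D'}$ denotes any one (the same for $D'=S$ and $D'=D$) of $e_Q^{D'}$, $s_Q^{D'}$, $d_Q^{D'}$.
   Context: $\mathcal L_\ell(a,y)=\tfrac12(1-ya)$ is the linear loss. For a distribution $D'$ on $\mathcal X\times\{-1,1\}$ (for $D'=S$, the uniform distribution on the sample): expected joint error $e_Q^{D'}=\mathbb E_{f_1\sim Q}\mathbb E_{f_2\sim Q}\mathbb E_{(x,y)\sim D'}\mathcal L_\ell(f_1(x),y)\mathcal L_\ell(f_2(x),y)$; expected joint success $s_Q^{D'}=\mathbb E_{f_1,f_2\sim Q}\mathbb E_{D'}[1-\mathcal L_\ell(f_1(x),y)][1-\mathcal L_\ell(f_2(x),y)]$; expected disagreement $d_Q^{D'}=\mathbb E_{f_1,f_2\sim Q}\mathbb E_{x\sim D'_{\mathcal X}}\mathcal L_\ell(f_1(x)f_2(x),1)=\tfrac12(1-\mathbb E_{x}[\mathbb E_{f\sim Q}f(x)]^2)$. $\mathrm{kl}(q\|p)=q\ln\frac qp+(1-q)\ln\frac{1-q}{1-p}$;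 $\mathrm{KL}(Q\|P)=\mathbb E_{f\sim Q}\ln\frac{Q(f)}{P(f)}$; $\xi(m)=\sum_{k=0}^m\binom mk(k/m)^k(1-k/m)^{m-k}$. $S\sim D^m$ i.i.d., $P$ independent of $S$. *)

theory Defs
  imports "HOL-Probability.Probability"
begin

definition lin_loss :: "real \<Rightarrow> real \<Rightarrow> real" where
  "lin_loss a y = (1 - y * a) / 2"

text \<open>Voters are indexed by points of a measurable space of type 'h; voter f x is the
  output of voter f on x. M is the data distribution (for the sample: uniform on it).\<close>

definition joint_error :: "('h \<Rightarrow> 'x \<Rightarrow> real) \<Rightarrow> 'h measure \<Rightarrow> ('x \<times> real) measure \<Rightarrow> real" where
  "joint_error voter Q M =
     (\<integral>f1. (\<integral>f2. (\<integral>z. lin_loss (voter f1 (fst z)) (snd z) * lin_loss (voter f2 (fst z)) (snd z) \<partial>M) \<partial>Q) \<partial>Q)"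

definition joint_success :: "('h \<Rightarrow> 'x \<Rightarrow> real) \<Rightarrow> 'h measure \<Rightarrow> ('x \<times> real) measure \<Rightarrow> real" where
  "joint_success voter Q M =
     (\<integral>f1. (\<integral>f2. (\<integral>z. (1 - lin_loss (voter f1 (fst z)) (snd z)) * (1 - lin_loss (voter f2 (fst z)) (snd z)) \<partial>M) \<partial>Q) \<partial>Q)"

text \<open>Disagreement: the expectation over the x-marginal is written as the expectation over
  (x,y) ~ M of a function of x only.\<close>
definition disagreement :: "('h \<Rightarrow> 'x \<Rightarrow> real) \<Rightarrow> 'h measure \<Rightarrow> ('x \<times> real) measure \<Rightarrow> real" where
  "disagreement voter Q M =
     (\<integral>f1. (\<integral>f2. (\<integral>z. lin_loss (voter f1 (fst z) * voter f2 (fst z)) 1 \<partial>M) \<partial>Q) \<partial>Q)"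

text \<open>Binary kl divergence with the usual conventions 0 ln 0 = 0 and c ln (c/0) = +infinity (c > 0).\<close>
definition kl_bin :: "real \<Rightarrow> real \<Rightarrow> ereal" where
  "kl_bin q p =
     (if q = 0 then 0 else if p = 0 then \<infinity> else ereal (q * ln (q / p))) +
     (if q = 1 then 0 else if p = 1 then \<infinity> else ereal ((1 - q) * ln ((1 - q) / (1 - p))))"

definition xi :: "nat \<Rightarrow> real" where
  "xi m = (\<Sum>k=0..m. real (m choose k) * (real k / real m) ^ k * (1 - real k / real m) ^ (m - k))"

definition empirical :: "nat \<Rightarrow> (nat \<Rightarrow> 'a) \<Rightarrow> 'a measure" where
  "empirical m S = measure_pmf (pmf_of_multiset (image_mset S (mset_set {..<m})))"

end

theory Submission
  imports Defs
begin

text \<open>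
  All three quantities are expectations, over a pair of voters drawn from the product of Q with
  itself, of a risk with values in [0, 1]; so the claim is a PAC-Bayesian kl bound for pairs, and the
  factor 2 appears because relative entropy is additive on product measures.

  For a fixed pair with risk p, exp (m kl(q || p)) at the empirical risk q is dominated by its
  multi-affine interpolation on the cube, i.e. by the case of Bernoulli losses, and there the
  factors p^k (1 - p)^(m - k) cancel, leaving xi(m). Integrating over the prior
  and applying Markov's inequality gives one event of probability at least 1 - \<delta>, on which the
  change of measure inequality of Donsker and Varadhan covers every posterior simultaneously. To
  pull the posterior expectation inside kl, kl is written as a supremum of functions affine
  in (q, p).
\<close>

section \<open>Binary kl as a supremum of affine functions\<close>

text \<open>Agrees with \<open>kl_bin\<close> for 0 < p < 1. At p in {0, 1} division by zero gives
  it meaningless finite values, so \<open>exp_kl\<close> consults it only in the interior.\<close>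

definition kl_real :: "real \<Rightarrow> real \<Rightarrow> real" where
  "kl_real q p = q * ln (q / p) + (1 - q) * ln ((1 - q) / (1 - p))"

text \<open>Optimising over a and b recovers kl(q || p). Since the expression is affine in (q, p),
  expectations over the posterior pass through it, which replaces Jensen's inequality for kl.\<close>
definition kl_affine :: "real \<Rightarrow> real \<Rightarrow> real \<Rightarrow> real \<Rightarrow> real" where
  "kl_affine a b q p = q * a + (1 - q) * b - p * (exp a - 1) - (1 - p) * (exp b - 1)"

lemma kl_affine_swap: "kl_affine a b q p = kl_affine b a (1 - q) (1 - p)"
  by (simp add: kl_affine_def)

lemma kl_bin_swap: "kl_bin q p = kl_bin (1 - q) (1 - p)"
  by (auto simp: kl_bin_def add.commute)

text \<open>Substituting a = ln (q / p) + t turns p exp a into q exp t, and exp t >= 1 + t gives the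
  claim. The terms - q + p cancel when the instances for (q, p) and (1 - q, 1 - p) are
  added.\<close>

lemma affine_le_mult_ln:
  fixes q p a :: real
  assumes "0 \<le> q" "0 < p"
  shows "q * a - p * (exp a - 1) \<le> q * ln (q / p) - q + p"
proof (cases "q = 0")
  case False
  with assms have q: "0 < q" by simp
  define t where "t = a - ln (q / p)"
  have "exp a = exp t * (q / p)"
    using q assms by (simp add: t_def exp_diff)
  then have "p * exp a = q * exp t"
    using assms by simp
  moreover have "q * (1 + t) \<le> q * exp t"
    using q by (intro mult_left_mono exp_ge_add_one_self) auto
  ultimately show ?thesis
    by (simp add: t_def algebra_simps)
qed (use assms in \<open>simp add: algebra_simps\<close>)

lemma kl_affine_le_kl_real:
  assumes "0 \<le> q" "q \<le> 1" "0 < p" "p < 1"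
  shows "kl_affine a b q p \<le> kl_real q p"
  using affine_le_mult_ln[of q p a] affine_le_mult_ln[of "1 - q" "1 - p" b] assms
  unfolding kl_affine_def kl_real_def by simp

lemma kl_affine_diag_le_0: "kl_affine a b 0 0 \<le> 0" "kl_affine a b 1 1 \<le> 0"
  using exp_ge_add_one_self[of a] exp_ge_add_one_self[of b]
  by (simp_all add: kl_affine_def algebra_simps)

text \<open>For q = 0 < p the supremum is only approached as a tends to minus infinity. If p < 1,
  the choice exp a = e, exp b = 1 / (1 - p) falls short of kl by p e <= e, with e arbitrary. If p =
  1 and a = 0, the form equals b, so no bound B exists.\<close>

lemma kl_bin_zero_left_le:
  assumes p: "0 \<le> p" "p \<le> 1" and B: "\<And>a b. kl_affine a b 0 p \<le> B"
  shows "kl_bin 0 p \<le> ereal B"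
proof (cases "p = 1")
  case True
  with B[of 0 "B + 1"] show ?thesis
    by (simp add: kl_affine_def)
next
  case False
  with p have p1: "p < 1" by simp
  have "ln (1 / (1 - p)) \<le> B + e" if "0 < e" for e
  proof -
    have "(1 - p) * (1 / (1 - p) - 1) = p"
      using p1 by (simp add: right_diff_distrib)
    then have "ln (1 / (1 - p)) - p * e \<le> B"
      using B[of "ln e" "ln (1 / (1 - p))"] p1 that
      by (simp add: kl_affine_def algebra_simps)
    moreover have "p * e \<le> 1 * e"
      using p that by (intro mult_right_mono) auto
    ultimately show ?thesis by simp
  qed
  then have "ln (1 / (1 - p)) \<le> B"
    by (rule field_le_epsilon)
  then show ?thesis
    using False by (simp add: kl_bin_def)
qed

text \<open>At p = 0, b = 0 the form is q a, unbounded in a: the affine counterpart of kl =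
  infinity.\<close>

lemma kl_affine_unbounded_right_zero:
  assumes "0 < q" "\<And>a b. kl_affine a b q 0 \<le> B"
  shows False
  using assms(2)[of "(B + 1) / q" 0] assms(1) by (simp add: kl_affine_def)

text \<open>Turns bounds on all affine forms back into a bound on kl. For 0 < q < 1, finiteness of B
  first excludes p in {0, 1}; then the maximiser is explicit. The endpoint q = 1 mirrors q =
  0.\<close>

lemma kl_bin_le:
  assumes q: "0 \<le> q" "q \<le> 1" and p: "0 \<le> p" "p \<le> 1"
    and B: "\<And>a b. kl_affine a b q p \<le> B"
  shows "kl_bin q p \<le> ereal B"
proof -
  have B': "\<And>a b. kl_affine a b (1 - q) (1 - p) \<le> B"
    using B kl_affine_swap by metis
  consider "q = 0" | "q = 1" | "0 < q" "q < 1" using q by linarith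
  then show ?thesis
  proof cases
    case 1
    then show ?thesis using kl_bin_zero_left_le p B by simp
  next
    case 2
    then show ?thesis
      using kl_bin_zero_left_le[of "1 - p" B] p B' kl_bin_swap[of q p] by simp
  next
    case 3
    then have "p \<noteq> 0" "p \<noteq> 1"
      using kl_affine_unbounded_right_zero[of q B] kl_affine_unbounded_right_zero[of "1 - q" B] B B'
      by auto
    with p have p': "0 < p" "p < 1" by auto
    \<comment> \<open>At a = ln (q / p), b = ln ((1 - q) / (1 - p)) the exponential terms are q - p
      and p - q and cancel, leaving kl.\<close>
    have "p * (q / p - 1) = q - p" "(1 - p) * ((1 - q) / (1 - p) - 1) = p - q"
      using p' by (simp_all add: field_simps)
    then have "kl_affine (ln (q / p)) (ln ((1 - q) / (1 - p))) q p = kl_real q p"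
      using 3 p' by (simp add: kl_affine_def kl_real_def)
    then show ?thesis
      using 3 p' B[of "ln (q / p)" "ln ((1 - q) / (1 - p))"] by (simp add: kl_bin_def kl_real_def)
  qed
qed

section \<open>The exponential of kl and the binomial likelihood\<close>

text \<open>The value exp (m kl(q || p)) for p in [0, 1], infinite where kl is infinite.\<close>
definition exp_kl :: "nat \<Rightarrow> real \<Rightarrow> real \<Rightarrow> ennreal" where
  "exp_kl m q p =
     (if 0 < p \<and> p < 1 then ennreal (exp (real m * kl_real q p)) else if q = p then 1 else \<top>)"

lemma measurable_exp_kl[measurable (raw)]:
  assumes [measurable]: "f \<in> borel_measurable M" "g \<in> borel_measurable M"
  shows "(\<lambda>x. exp_kl m (f x) (g x)) \<in> borel_measurable M"
  unfolding exp_kl_def kl_real_def by measurable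

text \<open>Links \<open>exp_kl\<close>, integrated over the prior, to the affine forms used for
  posteriors. For p in {0, 1} only q = p matters, \<open>exp_kl\<close> being infinite otherwise,
  and there the affine form is at most 0.\<close>

lemma exp_kl_affine_le_exp_kl:
  assumes "0 \<le> q" "q \<le> 1" "0 \<le> p" "p \<le> 1"
  shows "ennreal (exp (real m * kl_affine a b q p)) \<le> exp_kl m q p"
proof (cases "0 < p \<and> p < 1")
  case True
  then show ?thesis
    using kl_affine_le_kl_real[of q p a b] assms
    by (auto simp: exp_kl_def intro!: ennreal_leI mult_left_mono)
next
  case False
  with assms have "p = 0 \<or> p = 1" by auto
  then have "kl_affine a b p p \<le> 0"
    using kl_affine_diag_le_0 by auto
  then have "exp (real m * kl_affine a b p p) \<le> 1"
    by (simp add: mult_nonneg_nonpos)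
  then show ?thesis
    using False ennreal_leI[of _ 1] by (auto simp: exp_kl_def)
qed

text \<open>The maximum over q of the likelihood q^k (1 - q)^(m - k), attained at q = k / m.\<close>
definition ml_weight :: "nat \<Rightarrow> nat \<Rightarrow> real" where
  "ml_weight m k = (real k / real m) ^ k * (1 - real k / real m) ^ (m - k)"

lemma xi_eq_sum_ml_weight: "xi m = (\<Sum>k\<le>m. real (m choose k) * ml_weight m k)"
  by (simp add: xi_def ml_weight_def atLeast0AtMost mult.assoc)

lemma ml_weight_nonneg: "k \<le> m \<Longrightarrow> 0 \<le> ml_weight m k"
  by (auto simp: ml_weight_def divide_le_eq_1 intro!: mult_nonneg_nonneg zero_le_power)

text \<open>The term k = 0 equals 1. The bound settles risks 0 and 1, whose exponential moment is 1,
  and keeps the argument of ln (xi m / \<delta>) positive.\<close>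

lemma xi_ge_1: "1 \<le> xi m"
proof -
  have "real (m choose 0) * ml_weight m 0 \<le> xi m"
    unfolding xi_eq_sum_ml_weight by (rule member_le_sum) (auto simp: ml_weight_nonneg)
  then show ?thesis by (simp add: ml_weight_def)
qed

text \<open>Maximum likelihood without calculus: with r = k / m, the bound s <= exp (s - 1) at s = q
  / r and s = (1 - q) / (1 - r) compares both factors, and the exponents cancel. For k = 0 and k = m
  the weight is 1.\<close>

lemma binomial_likelihood_le_ml_weight:
  fixes q :: real
  assumes q: "0 \<le> q" "q \<le> 1" and k: "k \<le> m"
  shows "q ^ k * (1 - q) ^ (m - k) \<le> ml_weight m k"
proof -
  consider "k = 0" | "k = m" "0 < m" | "0 < k" "k < m" using k by linarith
  then show ?thesis
  proof cases
    case 1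
    then show ?thesis using q by (simp add: ml_weight_def power_le_one)
  next
    case 2
    then show ?thesis using q by (simp add: ml_weight_def power_le_one)
  next
    case 3
    define r where "r = real k / real m"
    have r: "0 < r" "r < 1" using 3 by (auto simp: r_def)
    have bound: "x ^ n \<le> y ^ n * exp (real n * (x / y - 1))" if "0 \<le> x" "0 < y" for x y :: real and n
    proof -
      have "x / y \<le> exp (x / y - 1)"
        using exp_ge_add_one_self[of "x / y - 1"] by simp
      then have "x \<le> y * exp (x / y - 1)"
        using that by (simp add: divide_le_eq mult.commute)
      then have "x ^ n \<le> (y * exp (x / y - 1)) ^ n"
        using that by (intro power_mono) auto
      then show ?thesis
        by (simp add: power_mult_distrib exp_of_nat_mult)
    qed
    have kr: "real k = real m * r" "real (m - k) = real m * (1 - r)"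
      using 3 by (auto simp: r_def of_nat_diff right_diff_distrib)
    \<comment> \<open>As k = m r, the two summands are m (q - r) and m (r - q).\<close>
    have "real k * (q / r - 1) + real (m - k) * ((1 - q) / (1 - r) - 1) = 0"
      unfolding kr using r by (simp add: field_simps)
    then have e: "exp (real k * (q / r - 1)) * exp (real (m - k) * ((1 - q) / (1 - r) - 1)) = 1"
      by (simp flip: exp_add)
    have "q ^ k * (1 - q) ^ (m - k) \<le>
      (r ^ k * exp (real k * (q / r - 1))) * ((1 - r) ^ (m - k) * exp (real (m - k) * ((1 - q) / (1 - r) - 1)))"
      using q r by (intro mult_mono bound) auto
    also have "\<dots> = ml_weight m k * (exp (real k * (q / r - 1)) * exp (real (m - k) * ((1 - q) / (1 - r) - 1)))"
      by (simp add: ml_weight_def r_def mult_ac)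
    finally show ?thesis by (simp add: e)
  qed
qed

section \<open>From losses in [0, 1] to Bernoulli losses\<close>

lemma mean_in_unit:
  fixes x :: "nat \<Rightarrow> real"
  assumes "\<And>i. i < m \<Longrightarrow> 0 \<le> x i \<and> x i \<le> 1"
  shows "0 \<le> (\<Sum>i<m. x i) / real m" "(\<Sum>i<m. x i) / real m \<le> 1"
proof -
  show "0 \<le> (\<Sum>i<m. x i) / real m"
    using assms by (auto intro!: divide_nonneg_nonneg sum_nonneg)
  have "(\<Sum>i<m. x i) \<le> (\<Sum>i<m. 1)"
    using assms by (intro sum_mono) auto
  then show "(\<Sum>i<m. x i) / real m \<le> 1"
    by (cases "m = 0") (auto simp: divide_le_eq_1)
qed

text \<open>As q is the mean of the x i, m kl(q || p) is the sum of x i ln (q / p) + (1 - x i) ln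
  ((1 - q) / (1 - p)), and convexity of exp bounds each factor. If q is 0 or 1, one logarithm
  degenerates, but then all x i equal q.\<close>

lemma exp_kl_real_le_prod:
  fixes x :: "nat \<Rightarrow> real"
  assumes x: "\<And>i. i < m \<Longrightarrow> 0 \<le> x i \<and> x i \<le> 1" and p: "0 < p" "p < 1" and m: "0 < m"
    and q: "q = (\<Sum>i<m. x i) / real m"
  shows "exp (real m * kl_real q p) \<le> (\<Prod>i<m. x i * (q / p) + (1 - x i) * ((1 - q) / (1 - p)))"
proof -
  have mq: "real m * q = (\<Sum>i<m. x i)" and mq': "real m * (1 - q) = (\<Sum>i<m. 1 - x i)"
    using m by (simp_all add: q right_diff_distrib sum_subtractf)
  have "0 \<le> q" "q \<le> 1"
    unfolding q using mean_in_unit[of m x] x by auto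
  then consider "q = 0" | "q = 1" | "0 < q" "q < 1" by linarith
  then show ?thesis
  proof cases
    case 1
    with mq have "(\<Sum>i<m. x i) = 0" by simp
    then have "x i = 0" if "i < m" for i
      using that x by (subst (asm) sum_nonneg_eq_0_iff) auto
    then show ?thesis
      using 1 p by (simp add: kl_real_def exp_of_nat_mult)
  next
    case 2
    with mq' have "(\<Sum>i<m. 1 - x i) = 0" by simp
    then have "x i = 1" if "i < m" for i
      using that x by (subst (asm) sum_nonneg_eq_0_iff) auto
    then show ?thesis
      using 2 p by (simp add: kl_real_def exp_of_nat_mult)
  next
    case 3
    define u v where "u = q / p" and "v = (1 - q) / (1 - p)"
    have uv: "0 < u" "0 < v" using 3 p by (auto simp: u_def v_def)
    have "real m * kl_real q p = (real m * q) * ln u + (real m * (1 - q)) * ln v"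
      by (simp add: kl_real_def u_def v_def algebra_simps)
    also have "\<dots> = (\<Sum>i<m. x i * ln u + (1 - x i) * ln v)"
      unfolding mq mq' by (simp add: sum_distrib_right sum.distrib)
    finally have "exp (real m * kl_real q p) = (\<Prod>i<m. exp (x i * ln u + (1 - x i) * ln v))"
      by (simp add: exp_sum)
    also have "\<dots> \<le> (\<Prod>i<m. x i * u + (1 - x i) * v)"
    proof (rule prod_mono, safe)
      fix i assume "i < m"
      then show "exp (x i * ln u + (1 - x i) * ln v) \<le> x i * u + (1 - x i) * v"
        using convex_onD[OF exp_convex, of "x i" "ln v" "ln u"] x[of i] uv
        by (simp add: algebra_simps)
    qed simp
    finally show ?thesis by (simp add: u_def v_def)
  qed
qed

text \<open>The right-hand side is the expectation of exp (m kl(K / m || p)) when K counts the successes of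
  independent Bernoulli variables with parameters x i: this is the reduction from [0, 1]-valued to
  binary losses.\<close>
lemma exp_kl_real_le_sum_Pow:
  fixes x :: "nat \<Rightarrow> real"
  assumes x: "\<And>i. i < m \<Longrightarrow> 0 \<le> x i \<and> x i \<le> 1" and p: "0 < p" "p < 1" and m: "0 < m"
  shows "exp (real m * kl_real ((\<Sum>i<m. x i) / real m) p) \<le>
    (\<Sum>J\<in>Pow {..<m}. ml_weight m (card J) / (p ^ card J * (1 - p) ^ (m - card J)) *
       (\<Prod>i<m. if i \<in> J then x i else 1 - x i))"
proof -
  define q where "q = (\<Sum>i<m. x i) / real m"
  have q: "0 \<le> q" "q \<le> 1"
    unfolding q_def using mean_in_unit[of m x] x by auto
  have "exp (real m * kl_real q p) \<le> (\<Prod>i<m. x i * (q / p) + (1 - x i) * ((1 - q) / (1 - p)))"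
    using x p m q_def by (rule exp_kl_real_le_prod)
  also have "\<dots> = (\<Sum>J\<in>Pow {..<m}. (\<Prod>i\<in>J. x i * (q / p)) * (\<Prod>i\<in>{..<m} - J. (1 - x i) * ((1 - q) / (1 - p))))"
    by (rule prod_add) simp
  also have "\<dots> \<le> (\<Sum>J\<in>Pow {..<m}. ml_weight m (card J) / (p ^ card J * (1 - p) ^ (m - card J)) *
       (\<Prod>i<m. if i \<in> J then x i else 1 - x i))"
  proof (rule sum_mono)
    fix J assume "J \<in> Pow {..<m}"
    then have J: "J \<subseteq> {..<m}" by simp
    then have fin: "finite J" and cJ: "card J \<le> m" and cJ': "card ({..<m} - J) = m - card J"
      using finite_subset[OF J] card_mono[OF _ J] card_Diff_subset[OF _ J] by auto
    have split: "(\<Prod>i<m. if i \<in> J then x i else 1 - x i) = (\<Prod>i\<in>J. x i) * (\<Prod>i\<in>{..<m} - J. 1 - x i)"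
      using J by (subst prod.subset_diff[OF J]) (auto simp: mult.commute intro!: arg_cong2[where f = "(*)"] prod.cong)
    have "0 \<le> (\<Prod>i<m. if i \<in> J then x i else 1 - x i)"
      using x by (auto intro!: prod_nonneg)
    \<comment> \<open>Here q still depends on x. Replacing its powers by their maximum over q makes
      the coefficient constant, so the bound becomes affine in each x i.\<close>
    then have "q ^ card J * (1 - q) ^ (m - card J) / (p ^ card J * (1 - p) ^ (m - card J)) *
        (\<Prod>i<m. if i \<in> J then x i else 1 - x i) \<le> ml_weight m (card J) / (p ^ card J * (1 - p) ^ (m - card J)) *
        (\<Prod>i<m. if i \<in> J then x i else 1 - x i)"
      using p q cJ by (intro mult_right_mono divide_right_mono binomial_likelihood_le_ml_weight) auto
    then show "(\<Prod>i\<in>J. x i * (q / p)) * (\<Prod>i\<in>{..<m} - J. (1 - x i) * ((1 - q) / (1 - p))) \<le>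
        ml_weight m (card J) / (p ^ card J * (1 - p) ^ (m - card J)) *
        (\<Prod>i<m. if i \<in> J then x i else 1 - x i)"
      unfolding split prod.distrib prod_constant cJ' by (simp add: power_divide mult_ac)
  qed
  finally show ?thesis by (simp add: q_def)
qed

lemma sum_Pow_card:
  fixes g :: "nat \<Rightarrow> real"
  assumes "finite A"
  shows "(\<Sum>J\<in>Pow A. g (card J)) = (\<Sum>k\<le>card A. real (card A choose k) * g k)"
proof -
  have "(\<Sum>J\<in>Pow A. g (card J)) = (\<Sum>k\<le>card A. \<Sum>J\<in>{J \<in> Pow A. card J = k}. g (card J))"
    using assms by (intro sum.group[symmetric]) (auto intro: card_mono)
  also have "\<dots> = (\<Sum>k\<le>card A. real (card A choose k) * g k)"
    using assms by (intro sum.cong refl) (simp add: n_subsets)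
  finally show ?thesis .
qed

section \<open>The exponential moment of a single loss\<close>

text \<open>By independence the product for a subset J integrates to p^|J| (1 - p)^(m - |J|), which
  cancels the denominator of \<open>c J\<close>. What remains is the sum of the weights over all
  subsets; grouped by cardinality it is xi m.\<close>

lemma nn_integral_exp_kl_le_xi:
  fixes \<phi> :: "'z \<Rightarrow> real"
  assumes D: "prob_space D" and \<phi>[measurable]: "\<phi> \<in> borel_measurable D"
    and \<phi>01: "\<And>z. z \<in> space D \<Longrightarrow> 0 \<le> \<phi> z \<and> \<phi> z \<le> 1" and m: "0 < m"
  shows "(\<integral>\<^sup>+S. exp_kl m ((\<Sum>i<m. \<phi> (S i)) / real m) (\<integral>z. \<phi> z \<partial>D) \<partial>(\<Pi>\<^sub>M i\<in>{..<m}. D)) \<le> ennreal (xi m)"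
proof -
  interpret D: prob_space D by fact
  interpret PD: product_prob_space "\<lambda>_::nat. D" "{..<m}" by unfold_locales
  define p where "p = (\<integral>z. \<phi> z \<partial>D)"
  have int\<phi>: "integrable D \<phi>"
    using \<phi>01 by (intro D.integrable_const_bound[where B = 1]) auto
  have p01: "0 \<le> p" "p \<le> 1"
    using \<phi>01 int\<phi> by (auto simp: p_def intro!: integral_nonneg_AE D.integral_le_const)
  have space: "S i \<in> space D" if "S \<in> space (\<Pi>\<^sub>M i\<in>{..<m}. D)" "i < m" for S i
    using that by (auto simp: space_PiM)
  show ?thesis
  proof (cases "0 < p \<and> p < 1")
    case True
    then have p: "0 < p" "p < 1" by auto
    define c where "c J = ml_weight m (card J) / (p ^ card J * (1 - p) ^ (m - card J))" for J :: "nat set"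
    define h where "h J i z = (if i \<in> J then \<phi> z else 1 - \<phi> z)" for J and i :: nat and z
    have int_h: "integrable D (h J i)" for J i
      using int\<phi> by (cases "i \<in> J") (simp_all add: h_def[abs_def])
    have int_H: "integrable (\<Pi>\<^sub>M i\<in>{..<m}. D) (\<lambda>S. \<Prod>i<m. h J i (S i))" for J
      by (rule PD.product_integrable_prod) (auto intro: int_h)
    have integral_h: "(\<integral>z. h J i z \<partial>D) = (if i \<in> J then p else 1 - p)" for J i
      using int\<phi> by (simp add: h_def p_def D.prob_space)
    have integral_H: "(\<integral>S. (\<Prod>i<m. h J i (S i)) \<partial>(\<Pi>\<^sub>M i\<in>{..<m}. D)) = p ^ card J * (1 - p) ^ (m - card J)"
      if J: "J \<subseteq> {..<m}" for J
    proof -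
      have "finite J" "card ({..<m} - J) = m - card J"
        using finite_subset[OF J] card_Diff_subset[OF _ J] by auto
      moreover have "(\<Prod>i<m. if i \<in> J then p else 1 - p) = (\<Prod>i\<in>J. p) * (\<Prod>i\<in>{..<m} - J. 1 - p)"
        by (subst prod.subset_diff[OF J]) (auto simp: mult.commute intro!: arg_cong2[where f = "(*)"] prod.cong)
      ultimately show ?thesis
        by (subst PD.product_integral_prod) (auto simp: int_h integral_h)
    qed
    have "(\<integral>\<^sup>+S. exp_kl m ((\<Sum>i<m. \<phi> (S i)) / real m) p \<partial>(\<Pi>\<^sub>M i\<in>{..<m}. D)) \<le>
        (\<integral>\<^sup>+S. ennreal (\<Sum>J\<in>Pow {..<m}. c J * (\<Prod>i<m. h J i (S i))) \<partial>(\<Pi>\<^sub>M i\<in>{..<m}. D))"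
    proof (rule nn_integral_mono)
      fix S assume "S \<in> space (\<Pi>\<^sub>M i\<in>{..<m}. D)"
      then have "0 \<le> \<phi> (S i) \<and> \<phi> (S i) \<le> 1" if "i < m" for i
        using that space \<phi>01 by blast
      from exp_kl_real_le_sum_Pow[OF this p m]
      show "exp_kl m ((\<Sum>i<m. \<phi> (S i)) / real m) p \<le> ennreal (\<Sum>J\<in>Pow {..<m}. c J * (\<Prod>i<m. h J i (S i)))"
        using p by (simp add: exp_kl_def c_def h_def ennreal_leI)
    qed
    also have "\<dots> = ennreal (\<integral>S. (\<Sum>J\<in>Pow {..<m}. c J * (\<Prod>i<m. h J i (S i))) \<partial>(\<Pi>\<^sub>M i\<in>{..<m}. D))"
    proof (rule nn_integral_eq_integral)
      show "integrable (\<Pi>\<^sub>M i\<in>{..<m}. D) (\<lambda>S. \<Sum>J\<in>Pow {..<m}. c J * (\<Prod>i<m. h J i (S i)))"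
        by (intro Bochner_Integration.integrable_sum integrable_mult_right int_H)
      have "0 \<le> c J" if "J \<subseteq> {..<m}" for J
        using p card_mono[OF _ that] by (auto simp: c_def intro!: divide_nonneg_nonneg ml_weight_nonneg)
      moreover have "0 \<le> h J i (S i)" if "S \<in> space (\<Pi>\<^sub>M i\<in>{..<m}. D)" "i < m" for S J i
        using \<phi>01[OF space[OF that]] by (simp add: h_def)
      ultimately show "AE S in \<Pi>\<^sub>M i\<in>{..<m}. D. 0 \<le> (\<Sum>J\<in>Pow {..<m}. c J * (\<Prod>i<m. h J i (S i)))"
        by (intro AE_I2 sum_nonneg mult_nonneg_nonneg prod_nonneg) auto
    qed
    also have "(\<integral>S. (\<Sum>J\<in>Pow {..<m}. c J * (\<Prod>i<m. h J i (S i))) \<partial>(\<Pi>\<^sub>M i\<in>{..<m}. D)) =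
        (\<Sum>J\<in>Pow {..<m}. c J * (p ^ card J * (1 - p) ^ (m - card J)))"
      by (subst Bochner_Integration.integral_sum) (auto simp: int_H integral_H intro!: sum.cong)
    also have "\<dots> = (\<Sum>J\<in>Pow {..<m}. ml_weight m (card J))"
      using p by (intro sum.cong) (auto simp: c_def)
    also have "\<dots> = xi m"
      by (simp add: sum_Pow_card xi_eq_sum_ml_weight)
    finally show ?thesis by (simp add: p_def)
  next
    case False
    with p01 have "p = 0 \<or> p = 1" by auto
    \<comment> \<open>Degenerate risk: \<phi> or 1 - \<phi> is nonnegative with integral 0. Hence
      the empirical risk is almost surely p, where \<open>exp_kl\<close> is 1.\<close>
    then have "AE z in D. \<phi> z = p"
    proof
      assume "p = 0"
      then show ?thesis
        using integral_nonneg_eq_0_iff_AE[OF int\<phi>] \<phi>01 by (auto simp: p_def)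
    next
      assume "p = 1"
      then have "(\<integral>z. 1 - \<phi> z \<partial>D) = 0"
        using int\<phi> by (simp add: p_def D.prob_space)
      then have "AE z in D. 1 - \<phi> z = 0"
        using \<phi>01 int\<phi> by (subst (asm) integral_nonneg_eq_0_iff_AE) auto
      then show ?thesis
        using \<open>p = 1\<close> by auto
    qed
    then have "AE S in \<Pi>\<^sub>M i\<in>{..<m}. D. \<forall>i\<in>{..<m}. \<phi> (S i) = p"
      by (intro AE_finite_allI AE_PiM_component[where M = "\<lambda>_. D"]) (auto simp: D)
    then have "AE S in \<Pi>\<^sub>M i\<in>{..<m}. D. exp_kl m ((\<Sum>i<m. \<phi> (S i)) / real m) p = 1"
      by eventually_elim (use False m in \<open>auto simp: exp_kl_def\<close>)
    then have "(\<integral>\<^sup>+S. exp_kl m ((\<Sum>i<m. \<phi> (S i)) / real m) p \<partial>(\<Pi>\<^sub>M i\<in>{..<m}. D)) =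
        (\<integral>\<^sup>+S. 1 \<partial>(\<Pi>\<^sub>M i\<in>{..<m}. D))"
      by (rule nn_integral_cong_AE)
    also have "\<dots> \<le> ennreal (xi m)"
      using ennreal_leI[OF xi_ge_1[of m]] by (simp add: PD.emeasure_space_1)
    finally show ?thesis by (simp add: p_def)
  qed
qed

section \<open>Relative entropy: change of measure and products\<close>

text \<open>\<open>RN_deriv\<close> takes extended nonnegative values. A real version, positive
  Q-almost everywhere, lets its logarithm be handled as a real function; base exp 1 makes it
  natural.\<close>

lemma entropy_density_ln_density:
  fixes P Q :: "'a measure"
  assumes P: "prob_space P" and Q: "prob_space Q" and sets: "sets Q = sets P"
    and ac: "absolutely_continuous P Q"
  obtains g :: "'a \<Rightarrow> real" where "g \<in> borel_measurable P" "\<And>x. 0 \<le> g x"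
    "Q = density P (\<lambda>x. ennreal (g x))" "AE x in Q. 0 < g x"
    "AE x in Q. entropy_density (exp 1) P Q x = ln (g x)"
proof -
  interpret P: prob_space P by fact
  interpret Q: prob_space Q by fact
  obtain g where g: "g \<in> borel_measurable P" "AE x in P. RN_deriv P Q x = ennreal (g x)"
    "AE x in Q. 0 < g x" "\<And>x. 0 \<le> g x"
    using P.real_RN_deriv[OF Q.finite_measure_axioms ac sets] by metis
  have "Q = density P (RN_deriv P Q)"
    using P.density_RN_deriv[OF ac sets] by simp
  also have "\<dots> = density P (\<lambda>x. ennreal (g x))"
    using g by (intro density_cong) auto
  finally have "Q = density P (\<lambda>x. ennreal (g x))" .
  moreover have "AE x in Q. RN_deriv P Q x = ennreal (g x)"
    using absolutely_continuous_AE[OF sets ac g(2)] .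
  then have "AE x in Q. entropy_density (exp 1) P Q x = ln (g x)"
    by eventually_elim (use g in \<open>simp add: entropy_density_def log_def\<close>)
  ultimately show thesis using g that by blast
qed

text \<open>The Donsker-Varadhan inequality. With g = dQ/dP and k = exp h / (C g), the moment bound
  gives k an integral of at most 1 under Q; integrating h - ln g - ln C = ln k <= k - 1 finishes.
  The moment bound does not mention Q, which makes the result uniform over posteriors.\<close>

lemma change_of_measure:
  fixes h :: "'a \<Rightarrow> real"
  assumes P: "prob_space P" and Q: "prob_space Q" and sets: "sets Q = sets P"
    and ac: "absolutely_continuous P Q" and int: "integrable Q (entropy_density (exp 1) P Q)"
    and h: "integrable Q h" and C: "0 < C" "(\<integral>\<^sup>+x. ennreal (exp (h x)) \<partial>P) \<le> ennreal C"
  shows "(\<integral>x. h x \<partial>Q) \<le> KL_divergence (exp 1) P Q + ln C"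
proof -
  interpret Q: prob_space Q by fact
  obtain g :: "'a \<Rightarrow> real" where g[measurable]: "g \<in> borel_measurable P" and g0: "\<And>x. 0 \<le> g x"
    and Qg: "Q = density P (\<lambda>x. ennreal (g x))" and gpos: "AE x in Q. 0 < g x"
    and ed: "AE x in Q. entropy_density (exp 1) P Q x = ln (g x)"
    using entropy_density_ln_density[OF P Q sets ac] by blast
  have gQ[measurable]: "g \<in> borel_measurable Q"
    using g measurable_cong_sets[OF sets refl] by blast
  have hQ[measurable]: "h \<in> borel_measurable Q"
    using h by auto
  have hP[measurable]: "h \<in> borel_measurable P"
    using hQ measurable_cong_sets[OF sets refl] by blast
  have int_ln: "integrable Q (\<lambda>x. ln (g x))"
    using int by (rule integrable_cong_AE_imp) (use ed in auto)
  have KL: "KL_divergence (exp 1) P Q = (\<integral>x. ln (g x) \<partial>Q)"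
    unfolding KL_divergence_def using ed int by (intro integral_cong_AE) auto
  define k where "k x = exp (h x) / (C * g x)" for x
  have [measurable]: "k \<in> borel_measurable P" "k \<in> borel_measurable Q"
    unfolding k_def by measurable
  have k0: "0 \<le> k x" for x using C g0 by (simp add: k_def)
  have "(\<integral>\<^sup>+x. ennreal (k x) \<partial>Q) = (\<integral>\<^sup>+x. ennreal (g x) * ennreal (k x) \<partial>P)"
    unfolding Qg by (rule nn_integral_density) auto
  also have "\<dots> \<le> (\<integral>\<^sup>+x. ennreal (1 / C) * ennreal (exp (h x)) \<partial>P)"
  proof (rule nn_integral_mono)
    fix x
    \<comment> \<open>Where g x = 0, division by zero makes \<open>k x\<close> zero, so only an
      inequality survives.\<close>
    have "g x * k x \<le> 1 / C * exp (h x)"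
      using C g0[of x] by (cases "g x = 0") (auto simp: k_def)
    then show "ennreal (g x) * ennreal (k x) \<le> ennreal (1 / C) * ennreal (exp (h x))"
      using g0[of x] k0[of x] C by (simp add: ennreal_leI flip: ennreal_mult)
  qed
  also have "\<dots> = ennreal (1 / C) * (\<integral>\<^sup>+x. ennreal (exp (h x)) \<partial>P)"
    by (rule nn_integral_cmult) auto
  also have "\<dots> \<le> ennreal (1 / C) * ennreal C"
    using C by (intro mult_left_mono) auto
  also have "\<dots> = 1"
    using C by (simp flip: ennreal_mult)
  finally have k1: "(\<integral>\<^sup>+x. ennreal (k x) \<partial>Q) \<le> ennreal 1" by simp
  have int_k: "integrable Q k"
    using k1 k0 by (intro integrableI_nonneg) (auto simp: less_top[symmetric] top_unique)
  have "ennreal (\<integral>x. k x \<partial>Q) \<le> ennreal 1"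
    using k1 nn_integral_eq_integral[OF int_k] k0 by simp
  then have k_le_1: "(\<integral>x. k x \<partial>Q) \<le> 1"
    by (subst (asm) ennreal_le_iff) auto
  have "(\<integral>x. h x - ln (g x) - ln C \<partial>Q) \<le> (\<integral>x. k x - 1 \<partial>Q)"
  proof (rule integral_mono_AE)
    show "AE x in Q. h x - ln (g x) - ln C \<le> k x - 1"
      using gpos
    proof eventually_elim
      case (elim x)
      then have "k x = exp (h x - ln (g x) - ln C)"
        using C by (simp add: k_def exp_diff)
      then show ?case
        using exp_ge_add_one_self[of "h x - ln (g x) - ln C"] by linarith
    qed
  qed (use h int_ln int_k in auto)
  also have "\<dots> \<le> 0"
    using int_k k_le_1 by (simp add: Q.prob_space)
  finally show ?thesis
    using h int_ln by (simp add: KL Q.prob_space)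
qed

text \<open>The product measure has density g1(x) g2(y), so its logarithm is a sum of functions of
  one coordinate each, integrated through the marginals. All three claims rest on this
  density.\<close>

lemma
  assumes P1: "prob_space P1" and Q1: "prob_space Q1" and sets1: "sets Q1 = sets P1"
    and ac1: "absolutely_continuous P1 Q1" and int1: "integrable Q1 (entropy_density (exp 1) P1 Q1)"
    and P2: "prob_space P2" and Q2: "prob_space Q2" and sets2: "sets Q2 = sets P2"
    and ac2: "absolutely_continuous P2 Q2" and int2: "integrable Q2 (entropy_density (exp 1) P2 Q2)"
  shows absolutely_continuous_pair_measure: "absolutely_continuous (P1 \<Otimes>\<^sub>M P2) (Q1 \<Otimes>\<^sub>M Q2)" (is ?ac)
    and integrable_entropy_density_pair_measure:
      "integrable (Q1 \<Otimes>\<^sub>M Q2) (entropy_density (exp 1) (P1 \<Otimes>\<^sub>M P2) (Q1 \<Otimes>\<^sub>M Q2))" (is ?int)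
    and KL_divergence_pair_measure: "KL_divergence (exp 1) (P1 \<Otimes>\<^sub>M P2) (Q1 \<Otimes>\<^sub>M Q2) =
      KL_divergence (exp 1) P1 Q1 + KL_divergence (exp 1) P2 Q2" (is ?KL)
proof -
  interpret P1: prob_space P1 by fact
  interpret P2: prob_space P2 by fact
  interpret Q1: prob_space Q1 by fact
  interpret Q2: prob_space Q2 by fact
  interpret P: pair_prob_space P1 P2 ..
  interpret Q: pair_prob_space Q1 Q2 ..
  obtain g1 where g1[measurable]: "g1 \<in> borel_measurable P1" and g10: "\<And>x. (0::real) \<le> g1 x"
    and Qg1: "Q1 = density P1 (\<lambda>x. ennreal (g1 x))" and g1pos: "AE x in Q1. 0 < g1 x"
    and ed1: "AE x in Q1. entropy_density (exp 1) P1 Q1 x = ln (g1 x)"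
    using entropy_density_ln_density[OF P1 Q1 sets1 ac1] by blast
  obtain g2 where g2[measurable]: "g2 \<in> borel_measurable P2" and g20: "\<And>x. (0::real) \<le> g2 x"
    and Qg2: "Q2 = density P2 (\<lambda>x. ennreal (g2 x))" and g2pos: "AE x in Q2. 0 < g2 x"
    and ed2: "AE x in Q2. entropy_density (exp 1) P2 Q2 x = ln (g2 x)"
    using entropy_density_ln_density[OF P2 Q2 sets2 ac2] by blast
  have [measurable]: "g1 \<in> borel_measurable Q1" "g2 \<in> borel_measurable Q2"
    using g1 g2 measurable_cong_sets[OF sets1 refl] measurable_cong_sets[OF sets2 refl] by blast+
  have setsQ: "sets (Q1 \<Otimes>\<^sub>M Q2) = sets (P1 \<Otimes>\<^sub>M P2)"
    using sets1 sets2 by (rule sets_pair_measure_cong)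
  have "Q1 \<Otimes>\<^sub>M Q2 = density P1 (\<lambda>x. ennreal (g1 x)) \<Otimes>\<^sub>M density P2 (\<lambda>x. ennreal (g2 x))"
    using Qg1 Qg2 by simp
  also have "\<dots> = density (P1 \<Otimes>\<^sub>M P2) (\<lambda>(x, y). ennreal (g1 x) * ennreal (g2 y))"
    using Qg2 Q2.sigma_finite_measure_axioms by (intro pair_measure_density P2.sigma_finite_measure_axioms) auto
  also have "\<dots> = density (P1 \<Otimes>\<^sub>M P2) (\<lambda>z. ennreal (g1 (fst z) * g2 (snd z)))"
    using g10 g20 by (intro arg_cong2[where f = density] refl) (auto simp: fun_eq_iff ennreal_mult)
  finally have Qd: "Q1 \<Otimes>\<^sub>M Q2 = density (P1 \<Otimes>\<^sub>M P2) (\<lambda>z. ennreal (g1 (fst z) * g2 (snd z)))" .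
  show ac: ?ac
    unfolding Qd by (rule absolutely_continuousI_density) measurable
  \<comment> \<open>\<open>RN_deriv\<close> is determined only almost everywhere under the product
    of the priors; absolute continuity transfers the identity to the posteriors.\<close>
  have "AE z in P1 \<Otimes>\<^sub>M P2. ennreal (g1 (fst z) * g2 (snd z)) = RN_deriv (P1 \<Otimes>\<^sub>M P2) (Q1 \<Otimes>\<^sub>M Q2) z"
    using Qd by (intro P.RN_deriv_unique) auto
  then have RN: "AE z in Q1 \<Otimes>\<^sub>M Q2. ennreal (g1 (fst z) * g2 (snd z)) = RN_deriv (P1 \<Otimes>\<^sub>M P2) (Q1 \<Otimes>\<^sub>M Q2) z"
    using absolutely_continuous_AE[OF setsQ ac] by blast
  have distr1: "distr (Q1 \<Otimes>\<^sub>M Q2) Q1 fst = Q1"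
    by (rule Q2.distr_pair_fst)
  have "distr (Q1 \<Otimes>\<^sub>M Q2) Q2 snd = distr (Q2 \<Otimes>\<^sub>M Q1) Q2 fst"
    by (subst Q.distr_pair_swap) (simp add: distr_distr comp_def split_beta)
  then have distr2: "distr (Q1 \<Otimes>\<^sub>M Q2) Q2 snd = Q2"
    by (simp add: Q1.distr_pair_fst)
  have int_ln1: "integrable Q1 (\<lambda>x. ln (g1 x))"
    using int1 by (rule integrable_cong_AE_imp) (use ed1 in auto)
  have int_ln2: "integrable Q2 (\<lambda>x. ln (g2 x))"
    using int2 by (rule integrable_cong_AE_imp) (use ed2 in auto)
  have KL1: "KL_divergence (exp 1) P1 Q1 = (\<integral>x. ln (g1 x) \<partial>Q1)"
    unfolding KL_divergence_def using ed1 int1 by (intro integral_cong_AE) auto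
  have KL2: "KL_divergence (exp 1) P2 Q2 = (\<integral>x. ln (g2 x) \<partial>Q2)"
    unfolding KL_divergence_def using ed2 int2 by (intro integral_cong_AE) auto
  \<comment> \<open>Both densities are positive almost everywhere, so ln of their product splits
    into a sum.\<close>
  have "AE z in Q1 \<Otimes>\<^sub>M Q2. 0 < g1 (fst z)"
    using g1pos by (intro AE_distrD[of fst _ Q1]) (simp, subst distr1)
  moreover have "AE z in Q1 \<Otimes>\<^sub>M Q2. 0 < g2 (snd z)"
    using g2pos by (intro AE_distrD[of snd _ Q2]) (simp, subst distr2)
  ultimately have ed: "AE z in Q1 \<Otimes>\<^sub>M Q2.
      ln (g1 (fst z)) + ln (g2 (snd z)) = entropy_density (exp 1) (P1 \<Otimes>\<^sub>M P2) (Q1 \<Otimes>\<^sub>M Q2) z"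
    using RN
  proof eventually_elim
    case (elim z)
    then show ?case
      by (simp add: entropy_density_def log_def ln_mult flip: elim(3))
  qed
  have [measurable]: "entropy_density (exp 1) (P1 \<Otimes>\<^sub>M P2) (Q1 \<Otimes>\<^sub>M Q2) \<in> borel_measurable (Q1 \<Otimes>\<^sub>M Q2)"
    using measurable_entropy_density measurable_cong_sets[OF setsQ refl] by blast
  have i1: "integrable (Q1 \<Otimes>\<^sub>M Q2) (\<lambda>z. ln (g1 (fst z)))"
    using int_ln1 by (intro integrable_distr[of fst _ Q1]) (simp, subst distr1)
  have i2: "integrable (Q1 \<Otimes>\<^sub>M Q2) (\<lambda>z. ln (g2 (snd z)))"
    using int_ln2 by (intro integrable_distr[of snd _ Q2]) (simp, subst distr2)
  have i12: "integrable (Q1 \<Otimes>\<^sub>M Q2) (\<lambda>z. ln (g1 (fst z)) + ln (g2 (snd z)))"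
    using i1 i2 by simp
  from this show ?int
    by (rule integrable_cong_AE_imp) (use ed in auto)
  have "KL_divergence (exp 1) (P1 \<Otimes>\<^sub>M P2) (Q1 \<Otimes>\<^sub>M Q2) =
      (\<integral>z. ln (g1 (fst z)) + ln (g2 (snd z)) \<partial>(Q1 \<Otimes>\<^sub>M Q2))"
    unfolding KL_divergence_def using ed by (intro integral_cong_AE) auto
  also have "\<dots> = (\<integral>z. ln (g1 (fst z)) \<partial>(Q1 \<Otimes>\<^sub>M Q2)) + (\<integral>z. ln (g2 (snd z)) \<partial>(Q1 \<Otimes>\<^sub>M Q2))"
    using i1 i2 by simp
  also have "(\<integral>z. ln (g1 (fst z)) \<partial>(Q1 \<Otimes>\<^sub>M Q2)) = (\<integral>x. ln (g1 x) \<partial>distr (Q1 \<Otimes>\<^sub>M Q2) Q1 fst)"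
    by (rule integral_distr[symmetric]) auto
  also have "(\<integral>z. ln (g2 (snd z)) \<partial>(Q1 \<Otimes>\<^sub>M Q2)) = (\<integral>x. ln (g2 x) \<partial>distr (Q1 \<Otimes>\<^sub>M Q2) Q2 snd)"
    by (rule integral_distr[symmetric]) auto
  finally show ?KL
    by (simp add: distr1 distr2 KL1 KL2)
qed

section \<open>The PAC-Bayesian kl bound for one loss\<close>

text \<open>Index space and loss are abstract so that pairs of voters can serve as indices. The
  conditions on \<open>Q\<close> say that KL(Q || P) is finite; for other posteriors the informal
  bound is vacuous.\<close>

theorem pac_bayes_kl:
  fixes L :: "'g \<Rightarrow> 'z \<Rightarrow> real"
  assumes D: "prob_space D" and P: "prob_space P"
    and L[measurable]: "(\<lambda>(f, z). L f z) \<in> borel_measurable (P \<Otimes>\<^sub>M D)"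
    and L01: "\<And>f z. f \<in> space P \<Longrightarrow> z \<in> space D \<Longrightarrow> 0 \<le> L f z \<and> L f z \<le> 1"
    and m: "0 < m" and \<delta>: "0 < \<delta>"
  shows "\<exists>A\<in>sets (\<Pi>\<^sub>M i\<in>{..<m}. D). measure (\<Pi>\<^sub>M i\<in>{..<m}. D) A \<ge> 1 - \<delta> \<and>
    (\<forall>S\<in>A. \<forall>Q. prob_space Q \<and> sets Q = sets P \<and> absolutely_continuous P Q
        \<and> integrable Q (entropy_density (exp 1) P Q) \<longrightarrow>
      kl_bin (\<integral>f. (\<Sum>i<m. L f (S i)) / real m \<partial>Q) (\<integral>f. (\<integral>z. L f z \<partial>D) \<partial>Q)
        \<le> ereal ((KL_divergence (exp 1) P Q + ln (xi m / \<delta>)) / real m))"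
proof -
  interpret D: prob_space D by fact
  interpret P: prob_space P by fact
  interpret PD: product_prob_space "\<lambda>_::nat. D" "{..<m}" by unfold_locales
  define M where "M = (\<Pi>\<^sub>M i\<in>{..<m}. D)"
  interpret M: prob_space M
    unfolding M_def by (rule PD.prob_space_axioms)
  interpret MP: pair_sigma_finite P M ..
  define C where "C = xi m / \<delta>"
  have C: "0 < C"
    using xi_ge_1[of m] \<delta> by (simp add: C_def)
  define r where "r f = (\<integral>z. L f z \<partial>D)" for f
  define e where "e S f = (\<Sum>i<m. L f (S i)) / real m" for S f
  have space: "S i \<in> space D" if "S \<in> space M" "i < m" for S i
    using that by (auto simp: M_def space_PiM)
  have Lf[measurable]: "L f \<in> borel_measurable D" if "f \<in> space P" for f
    using measurable_compose[OF measurable_Pair1'[OF that] L] by simp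
  have e01: "0 \<le> e S f" "e S f \<le> 1" if "S \<in> space M" "f \<in> space P" for S f
    unfolding e_def using that L01 space by (auto intro!: mean_in_unit)
  have intL: "integrable D (L f)" if "f \<in> space P" for f
    using that L01 by (intro D.integrable_const_bound[where B = 1]) auto
  have r01: "0 \<le> r f" "r f \<le> 1" if "f \<in> space P" for f
    using that L01 intL by (auto simp: r_def intro!: integral_nonneg_AE D.integral_le_const)
  have r_meas[measurable]: "r \<in> borel_measurable P"
    unfolding r_def by (rule D.borel_measurable_lebesgue_integral) simp
  have LS[measurable]: "(\<lambda>w. L (fst w) (snd w i)) \<in> borel_measurable (P \<Otimes>\<^sub>M M)" if "i < m" for i
  proof -
    have "(\<lambda>w. (fst w, snd w i)) \<in> measurable (P \<Otimes>\<^sub>M M) (P \<Otimes>\<^sub>M D)"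
      unfolding M_def using that
      by (intro measurable_Pair measurable_fst measurable_compose[OF measurable_snd measurable_component_singleton]) auto
    from measurable_compose[OF this L] show ?thesis by simp
  qed
  have e_meas: "(\<lambda>w. e (snd w) (fst w)) \<in> borel_measurable (P \<Otimes>\<^sub>M M)"
    unfolding e_def by (intro borel_measurable_divide borel_measurable_sum borel_measurable_const LS) auto
  have W: "(\<lambda>w. exp_kl m (e (snd w) (fst w)) (r (fst w))) \<in> borel_measurable (P \<Otimes>\<^sub>M M)"
    using e_meas by measurable
  then have W'[measurable]: "(\<lambda>w. exp_kl m (e (fst w) (snd w)) (r (snd w))) \<in> borel_measurable (M \<Otimes>\<^sub>M P)"
    using measurable_compose[OF measurable_pair_swap'[of M P] W] by (simp add: split_beta)
  \<comment> \<open>The prior average of exp (m kl). Exchanging integrals bounds its expectation by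
    xi m, as each fixed index satisfies the moment bound.\<close>
  define T where "T S = (\<integral>\<^sup>+f. exp_kl m (e S f) (r f) \<partial>P)" for S
  have T[measurable]: "T \<in> borel_measurable M"
    unfolding T_def by (rule P.borel_measurable_nn_integral) (use W' in \<open>simp add: split_beta\<close>)
  have "(\<integral>\<^sup>+S. T S \<partial>M) = (\<integral>\<^sup>+f. (\<integral>\<^sup>+S. exp_kl m (e S f) (r f) \<partial>M) \<partial>P)"
    unfolding T_def using W by (intro MP.Fubini') (simp add: split_beta)
  also have "\<dots> \<le> (\<integral>\<^sup>+f. ennreal (xi m) \<partial>P)"
  proof (rule nn_integral_mono)
    fix f assume "f \<in> space P"
    then show "(\<integral>\<^sup>+S. exp_kl m (e S f) (r f) \<partial>M) \<le> ennreal (xi m)"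
      unfolding e_def r_def M_def using L01 D m by (intro nn_integral_exp_kl_le_xi) auto
  qed
  also have "\<dots> = ennreal (xi m)"
    by (simp add: P.emeasure_space_1)
  finally have ET: "(\<integral>\<^sup>+S. T S \<partial>M) \<le> ennreal (xi m)" .
  \<comment> \<open>The event for Markov's inequality at threshold xi m / \<delta>; no posterior
    enters it.\<close>
  define A where "A = {S \<in> space M. T S \<le> ennreal C}"
  have A: "A \<in> sets M"
    unfolding A_def by measurable
  have "emeasure M (space M - A) \<le> emeasure M {S \<in> space M. 1 \<le> ennreal (1 / C) * T S}"
  proof (rule emeasure_mono)
    show "space M - A \<subseteq> {S \<in> space M. 1 \<le> ennreal (1 / C) * T S}"
    proof safe
      fix S assume "S \<in> space M" "S \<notin> A"
      then have "ennreal C \<le> T S" by (auto simp: A_def)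
      then have "ennreal (1 / C) * ennreal C \<le> ennreal (1 / C) * T S"
        by (intro mult_left_mono) auto
      then show "1 \<le> ennreal (1 / C) * T S"
        using C by (simp flip: ennreal_mult)
    qed
  qed measurable
  also have "\<dots> \<le> ennreal (1 / C) * (\<integral>\<^sup>+S. T S * indicator (space M) S \<partial>M)"
    by (intro nn_integral_Markov_inequality) auto
  also have "(\<integral>\<^sup>+S. T S * indicator (space M) S \<partial>M) = (\<integral>\<^sup>+S. T S \<partial>M)"
    by (intro nn_integral_cong) auto
  also have "ennreal (1 / C) * (\<integral>\<^sup>+S. T S \<partial>M) \<le> ennreal (1 / C) * ennreal (xi m)"
    using ET by (rule mult_left_mono) simp
  also have "\<dots> = ennreal \<delta>"
    using C xi_ge_1[of m] \<delta> by (simp add: C_def flip: ennreal_mult)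
  finally have "measure M (space M - A) \<le> \<delta>"
    using \<delta> by (simp add: M.emeasure_eq_measure)
  then have mA: "measure M A \<ge> 1 - \<delta>"
    using M.prob_compl[OF A] by simp
  have "kl_bin (\<integral>f. e S f \<partial>Q) (\<integral>f. r f \<partial>Q) \<le> ereal ((KL_divergence (exp 1) P Q + ln C) / real m)"
    if S: "S \<in> A" and Q: "prob_space Q" and sets: "sets Q = sets P" and ac: "absolutely_continuous P Q"
      and int: "integrable Q (entropy_density (exp 1) P Q)" for S Q
  proof (rule kl_bin_le)
    interpret Q: prob_space Q by fact
    have SM: "S \<in> space M" and TS: "T S \<le> ennreal C" using S by (auto simp: A_def)
    have spQ: "space Q = space P" using sets by (rule sets_eq_imp_space_eq)
    have eS: "e S \<in> borel_measurable P"
      using measurable_compose[OF measurable_Pair2'[OF SM] e_meas] by simp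
    have [measurable]: "r \<in> borel_measurable Q" "e S \<in> borel_measurable Q"
      using r_meas eS measurable_cong_sets[OF sets refl] by blast+
    have int_r: "integrable Q r"
      using r01 by (intro Q.integrable_const_bound[where B = 1]) (auto simp: spQ)
    have int_e: "integrable Q (e S)"
      using e01[OF SM] by (intro Q.integrable_const_bound[where B = 1]) (auto simp: spQ)
    show "0 \<le> (\<integral>f. e S f \<partial>Q)" "(\<integral>f. e S f \<partial>Q) \<le> 1"
      using e01[OF SM] int_e by (auto simp: spQ intro!: integral_nonneg_AE Q.integral_le_const)
    show "0 \<le> (\<integral>f. r f \<partial>Q)" "(\<integral>f. r f \<partial>Q) \<le> 1"
      using r01 int_r by (auto simp: spQ intro!: integral_nonneg_AE Q.integral_le_const)
    \<comment> \<open>T S <= C bounds the exponential moments of all affine forms at once, so a and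
      b may be chosen after S and Q.\<close>
    fix a b
    have "(\<integral>\<^sup>+f. ennreal (exp (real m * kl_affine a b (e S f) (r f))) \<partial>P) \<le> T S"
      unfolding T_def using e01[OF SM] r01 by (intro nn_integral_mono exp_kl_affine_le_exp_kl) auto
    also note TS
    finally have "(\<integral>f. real m * kl_affine a b (e S f) (r f) \<partial>Q) \<le> KL_divergence (exp 1) P Q + ln C"
      using int_e int_r by (intro change_of_measure P Q sets ac int C) (auto simp: kl_affine_def)
    moreover have "(\<integral>f. real m * kl_affine a b (e S f) (r f) \<partial>Q) =
        real m * kl_affine a b (\<integral>f. e S f \<partial>Q) (\<integral>f. r f \<partial>Q)"
      using int_e int_r by (simp add: kl_affine_def Q.prob_space)
    ultimately show "kl_affine a b (\<integral>f. e S f \<partial>Q) (\<integral>f. r f \<partial>Q) \<le>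
        (KL_divergence (exp 1) P Q + ln C) / real m"
      using m by (simp add: le_divide_eq mult.commute)
  qed
  then show ?thesis
    using A mA unfolding M_def e_def r_def C_def by blast
qed

section \<open>Pairs of voters and the sample distribution\<close>

text \<open>Repeated sample points keep their multiplicity in the multiset, so the measure is the
  image under S of the uniform distribution on indices. Being discrete, it integrates every g,
  measurable or not.\<close>

lemma integral_empirical:
  fixes g :: "'a \<Rightarrow> real"
  assumes "0 < m"
  shows "(\<integral>z. g z \<partial>empirical m S) = (\<Sum>i<m. g (S i)) / real m"
proof -
  have "{..<m} \<noteq> {}" using assms by auto
  then show ?thesis
    unfolding empirical_def
    by (subst map_pmf_of_set[symmetric]) (auto simp: integral_pmf_of_set)
qed

text \<open>The common form of the three claims. Joint error and joint success stay in [0, 1] only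
  at labels -1 and 1, hence the restricted range assumption on \<open>loss\<close>.\<close>

theorem pac_bayes_kl_pairs:
  fixes X :: "'x measure" and D :: "('x \<times> real) measure" and P :: "'h measure"
    and loss :: "'h \<Rightarrow> 'h \<Rightarrow> 'x \<times> real \<Rightarrow> real"
  assumes D: "prob_space D" and D_sets: "sets D = sets (X \<Otimes>\<^sub>M borel)"
    and labels: "AE z in D. snd z \<in> {-1, 1}" and P: "prob_space P"
    and loss: "(\<lambda>((f1, f2), z). loss f1 f2 z) \<in> borel_measurable ((P \<Otimes>\<^sub>M P) \<Otimes>\<^sub>M D)"
    and loss01: "\<And>f1 f2 z. f1 \<in> space P \<Longrightarrow> f2 \<in> space P \<Longrightarrow> z \<in> space D \<Longrightarrow> snd z \<in> {-1, 1} \<Longrightarrow>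
      0 \<le> loss f1 f2 z \<and> loss f1 f2 z \<le> 1"
    and m: "0 < m" and \<delta>: "0 < \<delta>"
  defines "\<alpha> \<equiv> \<lambda>Q M. \<integral>f1. (\<integral>f2. (\<integral>z. loss f1 f2 z \<partial>M) \<partial>Q) \<partial>Q"
  shows "\<exists>A\<in>sets (\<Pi>\<^sub>M i\<in>{..<m}. D). measure (\<Pi>\<^sub>M i\<in>{..<m}. D) A \<ge> 1 - \<delta> \<and>
    (\<forall>S\<in>A. \<forall>Q. prob_space Q \<and> sets Q = sets P \<and> absolutely_continuous P Q
        \<and> integrable Q (entropy_density (exp 1) P Q) \<longrightarrow>
      kl_bin (\<alpha> Q (empirical m S)) (\<alpha> Q D)
        \<le> ereal ((2 * KL_divergence (exp 1) P Q + ln (xi m / \<delta>)) / real m))"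
proof -
  interpret D: prob_space D by fact
  interpret P: prob_space P by fact
  interpret PP: pair_prob_space P P ..
  interpret PD: product_prob_space "\<lambda>_::nat. D" "{..<m}" by unfold_locales
  define M where "M = (\<Pi>\<^sub>M i\<in>{..<m}. D)"
  interpret M: prob_space M
    unfolding M_def by (rule PD.prob_space_axioms)
  \<comment> \<open>Truncation makes the bounds hold everywhere, not just for labels in {-1, 1}, i.e. D-almost everywhere.\<close>
  define L where "L f z = max 0 (min 1 (loss (fst f) (snd f) z))" for f z
  have L01: "0 \<le> L f z \<and> L f z \<le> 1" for f z
    by (auto simp: L_def)
  have L_eq: "L (f1, f2) z = loss f1 f2 z"
    if "f1 \<in> space P" "f2 \<in> space P" "z \<in> space D" "snd z \<in> {-1, 1}" for f1 f2 z
    using loss01[OF that] by (simp add: L_def)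
  have loss'[measurable]: "(\<lambda>w. loss (fst (fst w)) (snd (fst w)) (snd w)) \<in> borel_measurable ((P \<Otimes>\<^sub>M P) \<Otimes>\<^sub>M D)"
    using loss by (simp add: case_prod_unfold)
  have L_meas[measurable]: "(\<lambda>(f, z). L f z) \<in> borel_measurable ((P \<Otimes>\<^sub>M P) \<Otimes>\<^sub>M D)"
    unfolding L_def split_beta by measurable
  obtain A where A: "A \<in> sets M" "measure M A \<ge> 1 - \<delta>"
    and AQ: "\<And>S Q. S \<in> A \<Longrightarrow> prob_space Q \<Longrightarrow> sets Q = sets (P \<Otimes>\<^sub>M P) \<Longrightarrow>
      absolutely_continuous (P \<Otimes>\<^sub>M P) Q \<Longrightarrow> integrable Q (entropy_density (exp 1) (P \<Otimes>\<^sub>M P) Q) \<Longrightarrow>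
      kl_bin (\<integral>f. (\<Sum>i<m. L f (S i)) / real m \<partial>Q) (\<integral>f. (\<integral>z. L f z \<partial>D) \<partial>Q)
        \<le> ereal ((KL_divergence (exp 1) (P \<Otimes>\<^sub>M P) Q + ln (xi m / \<delta>)) / real m)"
    using pac_bayes_kl[OF D PP.prob_space_axioms L_meas L01 m \<delta>] unfolding M_def by blast
  have snd_meas[measurable]: "snd \<in> borel_measurable D"
    using measurable_snd[of X borel] measurable_cong_sets[OF D_sets refl] by blast
  \<comment> \<open>Labels are -1 or 1 only almost surely, while the bound must hold at every sample
    of the event; intersecting with the full-measure set \<open>G\<close> costs no
    probability.\<close>
  define G where "G = {S \<in> space M. \<forall>i\<in>{..<m}. snd (S i) \<in> {-1, 1}}"
  have G: "G \<in> sets M"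
    unfolding G_def M_def by measurable
  have "AE S in M. \<forall>i\<in>{..<m}. snd (S i) \<in> {-1, 1}"
    unfolding M_def using labels
    by (intro AE_finite_allI AE_PiM_component[where M = "\<lambda>_. D"]) (auto simp: D)
  then have G1: "AE S in M. S \<in> G"
    using AE_space by eventually_elim (auto simp: G_def)
  have "measure M (A \<inter> G) = measure M A"
    using G1 A(1) G by (intro M.finite_measure_eq_AE) auto
  moreover have "kl_bin (\<alpha> Q (empirical m S)) (\<alpha> Q D)
        \<le> ereal ((2 * KL_divergence (exp 1) P Q + ln (xi m / \<delta>)) / real m)"
    if S: "S \<in> A \<inter> G" and Q: "prob_space Q" and sets: "sets Q = sets P" and ac: "absolutely_continuous P Q"
      and int: "integrable Q (entropy_density (exp 1) P Q)" for S Q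
  proof -
    interpret Q: prob_space Q by fact
    interpret QQ: pair_prob_space Q Q ..
    have spQ: "space Q = space P" using sets by (rule sets_eq_imp_space_eq)
    have setsQQ: "sets (Q \<Otimes>\<^sub>M Q) = sets (P \<Otimes>\<^sub>M P)"
      using sets by (intro sets_pair_measure_cong) auto
    have spS: "S i \<in> space D" "snd (S i) \<in> {-1, 1}" if "i < m" for i
      using S that by (auto simp: G_def M_def space_PiM)
    have Lz: "(\<lambda>f. L f z) \<in> borel_measurable (Q \<Otimes>\<^sub>M Q)" if "z \<in> space D" for z
    proof -
      have "(\<lambda>f. L f z) \<in> borel_measurable (P \<Otimes>\<^sub>M P)"
        using measurable_compose[OF measurable_Pair2'[OF that] L_meas] by simp
      then show ?thesis
        using measurable_cong_sets[OF setsQQ refl] by blast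
    qed
    have "(\<lambda>f. \<integral>z. L f z \<partial>D) \<in> borel_measurable (P \<Otimes>\<^sub>M P)"
      by (rule D.borel_measurable_lebesgue_integral) simp
    then have r_meas: "(\<lambda>f. \<integral>z. L f z \<partial>D) \<in> borel_measurable (Q \<Otimes>\<^sub>M Q)"
      using measurable_cong_sets[OF setsQQ refl] by blast
    have Lf[measurable]: "L f \<in> borel_measurable D" if "f \<in> space (P \<Otimes>\<^sub>M P)" for f
      using measurable_compose[OF measurable_Pair1'[OF that] L_meas] by simp
    \<comment> \<open>On \<open>G\<close> the truncation changes nothing at the sample points, and
      boundedness lets Fubini's theorem merge the two posterior integrals.\<close>
    have "\<alpha> Q (empirical m S) = (\<integral>f1. (\<integral>f2. (\<Sum>i<m. L (f1, f2) (S i)) / real m \<partial>Q) \<partial>Q)"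
      unfolding \<alpha>_def integral_empirical[OF m]
      using spS by (intro Bochner_Integration.integral_cong refl) (simp add: spQ L_eq)
    also have "\<dots> = (\<integral>f. (\<Sum>i<m. L f (S i)) / real m \<partial>(Q \<Otimes>\<^sub>M Q))"
    proof (rule QQ.integral_fst')
      have "integrable (Q \<Otimes>\<^sub>M Q) (\<lambda>f. L f (S i))" if "i < m" for i
        using L01 Lz[OF spS(1)[OF that]] by (intro QQ.integrable_const_bound[where B = 1]) auto
      then show "integrable (Q \<Otimes>\<^sub>M Q) (\<lambda>f. (\<Sum>i<m. L f (S i)) / real m)"
        by (intro integrable_divide Bochner_Integration.integrable_sum) auto
    qed
    finally have eS: "\<alpha> Q (empirical m S) = (\<integral>f. (\<Sum>i<m. L f (S i)) / real m \<partial>(Q \<Otimes>\<^sub>M Q))" .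
    have "(\<integral>z. loss f1 f2 z \<partial>D) = (\<integral>z. L (f1, f2) z \<partial>D)" if f: "f1 \<in> space P" "f2 \<in> space P" for f1 f2
    proof (rule integral_cong_AE)
      have f': "(f1, f2) \<in> space (P \<Otimes>\<^sub>M P)" using f by (simp add: space_pair_measure)
      show "loss f1 f2 \<in> borel_measurable D"
        using measurable_compose[OF measurable_Pair1'[OF f'] loss'] by simp
      show "L (f1, f2) \<in> borel_measurable D" using Lf[OF f'] .
      show "AE z in D. loss f1 f2 z = L (f1, f2) z"
        using labels AE_space by eventually_elim (use f L_eq in auto)
    qed
    then have "\<alpha> Q D = (\<integral>f1. (\<integral>f2. (\<integral>z. L (f1, f2) z \<partial>D) \<partial>Q) \<partial>Q)"
      unfolding \<alpha>_def
      by (intro Bochner_Integration.integral_cong[OF refl, of Q]) (simp add: spQ)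
    also have "\<dots> = (\<integral>f. (\<integral>z. L f z \<partial>D) \<partial>(Q \<Otimes>\<^sub>M Q))"
    proof (rule QQ.integral_fst')
      have "0 \<le> (\<integral>z. L f z \<partial>D)" "(\<integral>z. L f z \<partial>D) \<le> 1" if "f \<in> space (P \<Otimes>\<^sub>M P)" for f
      proof -
        have "integrable D (L f)"
          using L01 that by (intro D.integrable_const_bound[where B = 1]) auto
        then show "0 \<le> (\<integral>z. L f z \<partial>D)" "(\<integral>z. L f z \<partial>D) \<le> 1"
          by (simp_all add: integral_nonneg_AE D.integral_le_const L01)
      qed
      then show "integrable (Q \<Otimes>\<^sub>M Q) (\<lambda>f. \<integral>z. L f z \<partial>D)"
        using r_meas by (intro QQ.integrable_const_bound[where B = 1])
          (auto simp: sets_eq_imp_space_eq[OF setsQQ])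
    qed
    finally have rD: "\<alpha> Q D = (\<integral>f. (\<integral>z. L f z \<partial>D) \<partial>(Q \<Otimes>\<^sub>M Q))" .
    \<comment> \<open>The same prior and posterior fill both components, so the relative entropy
      doubles.\<close>
    note pair = P Q sets ac int P Q sets ac int
    have "kl_bin (\<alpha> Q (empirical m S)) (\<alpha> Q D) \<le>
        ereal ((KL_divergence (exp 1) (P \<Otimes>\<^sub>M P) (Q \<Otimes>\<^sub>M Q) + ln (xi m / \<delta>)) / real m)"
      unfolding eS rD using S
      by (intro AQ QQ.prob_space_axioms setsQQ absolutely_continuous_pair_measure[OF pair]
          integrable_entropy_density_pair_measure[OF pair]) auto
    then show ?thesis
      by (simp add: KL_divergence_pair_measure[OF pair])
  qed
  ultimately show ?thesis
    using A G unfolding M_def by (intro bexI[of _ "A \<inter> G"]) auto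
qed

section \<open>Range and measurability of the three losses\<close>

lemma lin_loss_in_unit:
  assumes "a \<in> {-1..1}" "y \<in> {-1, 1}"
  shows "0 \<le> lin_loss a y \<and> lin_loss a y \<le> 1"
  using assms by (auto simp: lin_loss_def)

lemma mult_in_unit:
  fixes s t :: real
  assumes "0 \<le> s \<and> s \<le> 1" "0 \<le> t \<and> t \<le> 1"
  shows "0 \<le> s * t \<and> s * t \<le> 1"
  using assms by (simp add: mult_le_one)

theorem mainTheorem10:
  fixes X :: "'x measure" and Hs :: "'h measure"
    and voter :: "'h \<Rightarrow> 'x \<Rightarrow> real"
    and D :: "('x \<times> real) measure" and P :: "'h measure"
    and m :: nat and \<delta> :: real
    and \<alpha> :: "('h \<Rightarrow> 'x \<Rightarrow> real) \<Rightarrow> 'h measure \<Rightarrow> ('x \<times> real) measure \<Rightarrow> real"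
  assumes D_prob: "prob_space D"
    and D_sets: "sets D = sets (X \<Otimes>\<^sub>M borel)"
    and D_labels: "AE z in D. snd z \<in> {-1, 1}"
    and voter_meas: "(\<lambda>(f, x). voter f x) \<in> borel_measurable (Hs \<Otimes>\<^sub>M X)"
    and voter_range: "\<forall>f\<in>space Hs. \<forall>x\<in>space X. voter f x \<in> {-1..1}"
    and P_prob: "prob_space P" and P_sets: "sets P = sets Hs"
    and m_pos: "0 < m"
    and delta: "0 < \<delta>" "\<delta> \<le> 1"
    and alpha: "\<alpha> \<in> {joint_error, joint_success, disagreement}"
  shows "\<exists>A \<in> sets (PiM {..<m} (\<lambda>_. D)).
           measure (PiM {..<m} (\<lambda>_. D)) A \<ge> 1 - \<delta> \<and>
           (\<forall>S\<in>A. \<forall>Q. prob_space Q \<and> sets Q = sets Hs \<and> absolutely_continuous P Q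
                  \<and> integrable Q (entropy_density (exp 1) P Q) \<longrightarrow>
              kl_bin (\<alpha> voter Q (empirical m S)) (\<alpha> voter Q D)
                \<le> ereal ((2 * KL_divergence (exp 1) P Q + ln (xi m / \<delta>)) / real m))"
proof -
  let ?W = "(P \<Otimes>\<^sub>M P) \<Otimes>\<^sub>M D"
  have spD: "z \<in> space D \<Longrightarrow> fst z \<in> space X" for z
    using sets_eq_imp_space_eq[OF D_sets] by (auto simp: space_pair_measure)
  have spP: "space P = space Hs"
    using P_sets by (rule sets_eq_imp_space_eq)
  have sets_W: "sets ?W = sets ((Hs \<Otimes>\<^sub>M Hs) \<Otimes>\<^sub>M (X \<Otimes>\<^sub>M borel))"
    by (intro sets_pair_measure_cong P_sets D_sets)
  have voter1: "(\<lambda>w. voter (fst (fst w)) (fst (snd w))) \<in> borel_measurable ?W"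
  proof -
    have "(\<lambda>w. (fst (fst w), fst (snd w))) \<in> measurable ((Hs \<Otimes>\<^sub>M Hs) \<Otimes>\<^sub>M (X \<Otimes>\<^sub>M (borel :: real measure))) (Hs \<Otimes>\<^sub>M X)"
      by measurable
    from measurable_compose[OF this voter_meas] show ?thesis
      using measurable_cong_sets[OF sets_W refl] by auto
  qed
  have voter2: "(\<lambda>w. voter (snd (fst w)) (fst (snd w))) \<in> borel_measurable ?W"
  proof -
    have "(\<lambda>w. (snd (fst w), fst (snd w))) \<in> measurable ((Hs \<Otimes>\<^sub>M Hs) \<Otimes>\<^sub>M (X \<Otimes>\<^sub>M (borel :: real measure))) (Hs \<Otimes>\<^sub>M X)"
      by measurable
    from measurable_compose[OF this voter_meas] show ?thesis
      using measurable_cong_sets[OF sets_W refl] by auto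
  qed
  have label: "(\<lambda>w. snd (snd w)) \<in> borel_measurable ?W"
  proof -
    have "(\<lambda>w. snd (snd w)) \<in> borel_measurable ((Hs \<Otimes>\<^sub>M Hs) \<Otimes>\<^sub>M (X \<Otimes>\<^sub>M (borel :: real measure)))"
      by measurable
    then show ?thesis
      using measurable_cong_sets[OF sets_W refl] by blast
  qed
  note [measurable] = voter1 voter2 label
  have voter01: "voter f (fst z) \<in> {-1..1}" if "f \<in> space P" "z \<in> space D" for f z
    using voter_range that spD spP by auto
  \<comment> \<open>The two open premises, measurability and range of the loss, are all that is left
    to each case.\<close>
  note bound = pac_bayes_kl_pairs[OF D_prob D_sets D_labels P_prob _ _ m_pos delta(1), unfolded P_sets]
  from alpha consider "\<alpha> = joint_error" | "\<alpha> = joint_success" | "\<alpha> = disagreement" by auto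
  then show ?thesis
  proof cases
    case 1
    show ?thesis
      unfolding 1 joint_error_def
    proof (rule bound)
      show "(\<lambda>((f1, f2), z). lin_loss (voter f1 (fst z)) (snd z) * lin_loss (voter f2 (fst z)) (snd z))
          \<in> borel_measurable ?W"
        unfolding lin_loss_def split_beta by measurable
    qed (intro mult_in_unit lin_loss_in_unit voter01; assumption)
  next
    case 2
    show ?thesis
      unfolding 2 joint_success_def
    proof (rule bound)
      show "(\<lambda>((f1, f2), z). (1 - lin_loss (voter f1 (fst z)) (snd z)) * (1 - lin_loss (voter f2 (fst z)) (snd z)))
          \<in> borel_measurable ?W"
        unfolding lin_loss_def split_beta by measurable
    next
      fix f1 f2 z assume "f1 \<in> space P" "f2 \<in> space P" "z \<in> space D" "snd z \<in> {-1, 1::real}"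
      then show "0 \<le> (1 - lin_loss (voter f1 (fst z)) (snd z)) * (1 - lin_loss (voter f2 (fst z)) (snd z)) \<and>
          (1 - lin_loss (voter f1 (fst z)) (snd z)) * (1 - lin_loss (voter f2 (fst z)) (snd z)) \<le> 1"
        using lin_loss_in_unit[OF voter01] by (intro mult_in_unit) simp_all
    qed
  next
    case 3
    show ?thesis
      unfolding 3 disagreement_def
    proof (rule bound)
      show "(\<lambda>((f1, f2), z). lin_loss (voter f1 (fst z) * voter f2 (fst z)) 1) \<in> borel_measurable ?W"
        unfolding lin_loss_def split_beta by measurable
    next
      fix f1 f2 z assume "f1 \<in> space P" "f2 \<in> space P" "z \<in> space D"
      then have "\<bar>voter f1 (fst z)\<bar> \<le> 1" "\<bar>voter f2 (fst z)\<bar> \<le> 1"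
        using voter01 by (auto simp: abs_le_iff)
      \<comment> \<open>A product of two outputs is again in [-1, 1], so disagreement is a linear
        loss at label 1.\<close>
      then have "\<bar>voter f1 (fst z) * voter f2 (fst z)\<bar> \<le> 1"
        by (simp add: abs_mult mult_le_one)
      then show "0 \<le> lin_loss (voter f1 (fst z) * voter f2 (fst z)) 1 \<and>
          lin_loss (voter f1 (fst z) * voter f2 (fst z)) 1 \<le> 1"
        by (intro lin_loss_in_unit) (auto simp: abs_le_iff)
    qed
  qed
qed

end
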